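(* Let $k\ge3$ be a fixed integer, let $P$ and $Q$ be probability distributions on a finite commutative ring $R$, and let $p=|\operatorname{supp}(P)|$. If $\ell(P,Q)<\infty$, then $$\frac{\sum_{i=1}^{\ell(P,Q)}k(k-1)^{i-1}}{1+\sum_{i=1}^{\ell(P,Q)}k(k-1)^{i-1}}\le\alpha_{P,Q}\le\frac{\sum_{i=1}^{\ell(P,Q)}k(k-1)^{i-1}p^{2i}}{1+\sum_{i=1}^{\ell(P,Q)}k(k-1)^{i-1}p^{2i}}.$$
   Context: Rings are finite, commutative, with identity; $(r)=rR$. Definition of $\alpha_{P,Q}$. A factor graph $F$ is a finite bipartite graph with vertex classes $V(F)$ (variable vertices) and $C(F)$ (constraint vertices), in which every constraint vertex has degree exactly $k$. A weighted factor graph $(F,w)$ carries a weight $w(cv)\in R$ on every edge $cv$ and a weight $w(c)\in R$ on every constraint vertex $c$. It is satisfiable if there is $x\in R^{V(F)}$ with $\sum_{v\in N(c)}w(cv)x_v=w(c)$ for every $c\in C(F)$, and unsatisfiable otherwise. $\mathcal T(P,Q)$ is the set of unsatisfiable, connected, acyclic weighted factor graphs with all edge weights in $\operatorname{supp}(P)$ and all constraint vertex weights in $\operatorname{supp}(Q)$. Set $$\alpha_{P,Q}=1-\frac{1}{\inf\{|C(T)|:T\in\mathcal T(P,Q)\}},$$ with $\alpha_{P,Q}=1$ if $\mathcal T(P,Q)=\emptyset$. Definition of $\ell(P,Q)$. For an ideal $I$ and $s\in R$, $(I:s)=\{t\in R: st\in I\}$. Define $I_0(P)=\bigcap_{r\in\operatorname{supp}(P)}(r)$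 and, for $\ell\ge1$, $$I_\ell(P)=\bigcap_{r\in\operatorname{supp}(P)}r\Big(\bigcap_{s\in\operatorname{supp}(P)}(I_{\ell-1}(P):s)\Big).$$ Then $\ell(P,Q)=\inf\{\ell\ge0:\operatorname{supp}(Q)\not\subseteq I_\ell(P)\}$, with $\inf\emptyset=\infty$. *)

theory Defs
  imports "HOL-Probability.Probability_Mass_Function" "HOL-Library.Extended_Nat"
begin

text \<open>
  The sort \<open>{finite, comm_ring, comm_monoid_mult}\<close> is that of finite commutative rings with
  identity; unlike \<open>comm_ring_1\<close> it does not exclude the zero ring. A probability
  distribution on such a ring is a \<open>pmf\<close>, with support \<open>set_pmf\<close>.
\<close>

section \<open>Weighted factor graphs\<close>

text \<open>
  The two vertex classes live in separate types, so the vertices of the bipartite graph are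
  elements of the sum type \<open>'v + 'c\<close>. An edge is written as a pair (constraint, variable).
  Weights are total functions; only their values on edges and constraint vertices matter.
\<close>

record ('v, 'c) factor_graph =
  variables :: "'v set"
  constraints :: "'c set"
  edges :: "('c \<times> 'v) set"

record ('v, 'c, 'r) weighted_factor_graph = "('v, 'c) factor_graph" +
  edge_weight :: "'c \<Rightarrow> 'v \<Rightarrow> 'r"
  constraint_weight :: "'c \<Rightarrow> 'r"

definition nbrs :: "('v, 'c, 'z) factor_graph_scheme \<Rightarrow> 'c \<Rightarrow> 'v set" where
  "nbrs F c = {v. (c, v) \<in> edges F}"

definition is_factor_graph :: "nat \<Rightarrow> ('v, 'c, 'z) factor_graph_scheme \<Rightarrow> bool" where
  "is_factor_graph k F \<longleftrightarrow>
     finite (variables F) \<and> finite (constraints F) \<and>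
     edges F \<subseteq> constraints F \<times> variables F \<and>
     (\<forall>c\<in>constraints F. card (nbrs F c) = k)"

definition vertices :: "('v, 'c, 'z) factor_graph_scheme \<Rightarrow> ('v + 'c) set" where
  "vertices F = variables F <+> constraints F"

definition adjacent :: "('v, 'c, 'z) factor_graph_scheme \<Rightarrow> 'v + 'c \<Rightarrow> 'v + 'c \<Rightarrow> bool" where
  "adjacent F x y \<longleftrightarrow>
     (\<exists>(c, v)\<in>edges F. (x = Inl v \<and> y = Inr c) \<or> (x = Inr c \<and> y = Inl v))"

definition connected_graph :: "('v, 'c, 'z) factor_graph_scheme \<Rightarrow> bool" where
  "connected_graph F \<longleftrightarrow>
     vertices F \<noteq> {} \<and> (\<forall>x\<in>vertices F. \<forall>y\<in>vertices F. (adjacent F)\<^sup>*\<^sup>* x y)"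

definition is_cycle :: "('v, 'c, 'z) factor_graph_scheme \<Rightarrow> ('v + 'c) list \<Rightarrow> bool" where
  "is_cycle F xs \<longleftrightarrow>
     3 \<le> length xs \<and> distinct xs \<and> successively (adjacent F) xs \<and> adjacent F (last xs) (hd xs)"

definition acyclic_graph :: "('v, 'c, 'z) factor_graph_scheme \<Rightarrow> bool" where
  "acyclic_graph F \<longleftrightarrow> (\<nexists>xs. is_cycle F xs)"

definition satisfiable ::
    "('v, 'c, 'r :: {finite, comm_ring, comm_monoid_mult}) weighted_factor_graph \<Rightarrow> bool" where
  "satisfiable F \<longleftrightarrow>
     (\<exists>x. \<forall>c\<in>constraints F. (\<Sum>v\<in>nbrs F c. edge_weight F c v * x v) = constraint_weight F c)"


section \<open>The threshold\<close>

text \<open>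
  Every finite graph has an isomorphic copy with natural numbers as vertices, so labelling by
  naturals loses no graph and makes the class of trees a set.
\<close>

definition unsat_trees ::
    "nat \<Rightarrow> ('r :: {finite, comm_ring, comm_monoid_mult}) pmf \<Rightarrow> 'r pmf
      \<Rightarrow> (nat, nat, 'r) weighted_factor_graph set" where
  "unsat_trees k P Q =
     {T. is_factor_graph k T \<and> connected_graph T \<and> acyclic_graph T \<and> \<not> satisfiable T \<and>
         (\<forall>(c, v)\<in>edges T. edge_weight T c v \<in> set_pmf P) \<and>
         (\<forall>c\<in>constraints T. constraint_weight T c \<in> set_pmf Q)}"

definition alpha ::
    "nat \<Rightarrow> ('r :: {finite, comm_ring, comm_monoid_mult}) pmf \<Rightarrow> 'r pmf \<Rightarrow> real" where
  "alpha k P Q =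
     (if unsat_trees k P Q = {} then 1
      else 1 - 1 / real (INF T\<in>unsat_trees k P Q. card (constraints T)))"


section \<open>The ideals and the level\<close>

definition colon :: "('r :: comm_ring) set \<Rightarrow> 'r \<Rightarrow> 'r set" where
  "colon I s = {t. s * t \<in> I}"

primrec level_ideal :: "('r :: {finite, comm_ring, comm_monoid_mult}) pmf \<Rightarrow> nat \<Rightarrow> 'r set" where
  "level_ideal P 0 = (\<Inter>r\<in>set_pmf P. range ((*) r))"
| "level_ideal P (Suc l) =
     (\<Inter>r\<in>set_pmf P. (*) r ` (\<Inter>s\<in>set_pmf P. colon (level_ideal P l) s))"

definition level ::
    "('r :: {finite, comm_ring, comm_monoid_mult}) pmf \<Rightarrow> 'r pmf \<Rightarrow> enat" where
  "level P Q = (INF l\<in>{l. \<not> set_pmf Q \<subseteq> level_ideal P l}. enat l)"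

end

theory Submission imports Defs "HOL-Library.Transitive_Closure_Table" begin

text \<open>
  Write \<open>J\<^sub>0 = R\<close>, \<open>J\<^sub>l\<^sub>+\<^sub>1 = \<Inter>\<^sub>s (I\<^sub>l : s)\<close>, so that \<open>I\<^sub>l = \<Inter>\<^sub>r r J\<^sub>l\<close>, and let \<open>L\<close> be the level.

  Lower bound. If every constraint \<open>c\<close> had a neighbour whose branch away from \<open>c\<close> is shallow,
  then the right-hand side at \<open>c\<close> could be met by giving that neighbour a value in \<open>J\<^sub>L\<^sub>-\<^sub>1\<close> and
  cancelling it along the branch; by linearity the tree would be satisfiable. Hence all \<open>k\<close>
  branches at some constraint are not shallow, and since they are disjoint the constraints in
  them can be counted recursively.

  Upper bound. Take \<open>q \<in> supp Q\<close> outside \<open>I\<^sub>L\<close>, say \<open>q \<notin> r J\<^sub>L\<close>, and give all constraints the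
  weight \<open>q\<close>. Let the edges at the root have weight \<open>r\<close>, and below each variable hang one
  constraint for each pair \<open>(s, t)\<close> in the support of \<open>P\<close>. As \<open>q \<in> I\<^sub>l\<close> for \<open>l < L\<close>, these
  constraints force \<open>s x\<close> into \<open>t J\<^sub>l\<close> for all \<open>s, t\<close>, that is \<open>x\<close> into \<open>J\<^sub>l\<^sub>+\<^sub>1\<close>, which at the
  root contradicts the choice of \<open>r\<close>.
\<close>

section \<open>Value ideals\<close>

text \<open>The \<open>J\<^sub>l\<close> above. The base value \<open>UNIV\<close> lets
  \<open>I\<^sub>0\<close> and all later \<open>I\<^sub>l\<close> share one formula.\<close>

primrec value_ideal :: "('r :: {finite, comm_ring, comm_monoid_mult}) pmf \<Rightarrow> nat \<Rightarrow> 'r set" where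
  "value_ideal P 0 = UNIV"
| "value_ideal P (Suc l) = (\<Inter>s\<in>set_pmf P. colon (level_ideal P l) s)"

lemma level_ideal_eq: "level_ideal P l = (\<Inter>r\<in>set_pmf P. (*) r ` value_ideal P l)"
  by (cases l) auto

lemma level_ideal_subset: "r \<in> set_pmf P \<Longrightarrow> level_ideal P l \<subseteq> (*) r ` value_ideal P l"
  unfolding level_ideal_eq by blast

lemma times_value_ideal: "s \<in> set_pmf P \<Longrightarrow> y \<in> value_ideal P (Suc l) \<Longrightarrow> s * y \<in> level_ideal P l"
  by (auto simp: colon_def)

lemma zero_value_ideal: "0 \<in> value_ideal P l"
proof (induction l)
  case (Suc l)
  have "0 \<in> level_ideal P l"
    unfolding level_ideal_eq
  proof
    fix r assume "r \<in> set_pmf P"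
    show "0 \<in> (*) r ` value_ideal P l"
      using Suc by (intro image_eqI[where x = 0]) auto
  qed
  then show ?case by (simp add: colon_def)
qed simp

lemma image_times_diff:
  fixes r :: "'r :: comm_ring"
  assumes "\<And>x y. x \<in> J \<Longrightarrow> y \<in> J \<Longrightarrow> x - y \<in> J" "a \<in> (*) r ` J" "b \<in> (*) r ` J"
  shows "a - b \<in> (*) r ` J"
proof -
  obtain x y where "x \<in> J" "y \<in> J" "a = r * x" "b = r * y" using assms(2,3) by blast
  then have "a - b = r * (x - y)" "x - y \<in> J" using assms(1) by (simp_all add: right_diff_distrib)
  then show ?thesis by blast
qed

text \<open>Closure of \<open>value_ideal P l\<close> is a premise because this lemma serves inside
  the induction that proves that closure.\<close>

lemma level_ideal_diffI:
  assumes "\<And>x y. x \<in> value_ideal P l \<Longrightarrow> y \<in> value_ideal P l \<Longrightarrow> x - y \<in> value_ideal P l"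
    and "a \<in> level_ideal P l" "b \<in> level_ideal P l"
  shows "a - b \<in> level_ideal P l"
  unfolding level_ideal_eq
proof
  fix r assume "r \<in> set_pmf P"
  then have "a \<in> (*) r ` value_ideal P l" "b \<in> (*) r ` value_ideal P l"
    using assms(2,3) level_ideal_subset by blast+
  with assms(1) show "a - b \<in> (*) r ` value_ideal P l" by (intro image_times_diff)
qed

text \<open>Differences rather than sums: since \<open>0\<close> is a member, this one induction
  yields negatives and hence sums.\<close>

lemma value_ideal_diff:
  "x \<in> value_ideal P l \<Longrightarrow> y \<in> value_ideal P l \<Longrightarrow> x - y \<in> value_ideal P l"
proof (induction l arbitrary: x y)
  case (Suc l)
  have "s * (x - y) \<in> level_ideal P l" if "s \<in> set_pmf P" for s
    using level_ideal_diffI[OF Suc.IH times_value_ideal[OF that Suc.prems(1)]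
        times_value_ideal[OF that Suc.prems(2)]]
    by (simp add: right_diff_distrib)
  then show ?case by (simp add: colon_def)
qed simp

lemma value_ideal_add:
  assumes "x \<in> value_ideal P l" "y \<in> value_ideal P l"
  shows "x + y \<in> value_ideal P l"
  using value_ideal_diff[OF assms(1) value_ideal_diff[OF zero_value_ideal assms(2)]] by simp

lemma value_ideal_sum: "(\<And>i. i \<in> A \<Longrightarrow> f i \<in> value_ideal P l) \<Longrightarrow> sum f A \<in> value_ideal P l"
  by (induction A rule: infinite_finite_induct) (auto intro: zero_value_ideal value_ideal_add)

lemma level_ideal_uminus:
  assumes "x \<in> level_ideal P l"
  shows "- x \<in> level_ideal P l"
  using level_ideal_diffI[OF value_ideal_diff level_ideal_diffI[OF value_ideal_diff assms assms] assms]
  by simp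

text \<open>\<open>enat\<close> is well-ordered, so the infimum of a nonempty set is
  attained.\<close>

lemma level_eq_enatD:
  assumes "level P Q < \<infinity>"
  obtains L where "level P Q = enat L" "\<not> set_pmf Q \<subseteq> level_ideal P L"
    "\<And>l. l < L \<Longrightarrow> set_pmf Q \<subseteq> level_ideal P l"
proof -
  define A where "A = enat ` {l. \<not> set_pmf Q \<subseteq> level_ideal P l}"
  have eq: "level P Q = Inf A" by (simp add: level_def A_def)
  have "A \<noteq> {}" using assms by (auto simp: eq Inf_enat_def)
  then have "Inf A \<in> A" by (meson ex_in_conv wellorder_InfI)
  then obtain L where L: "level P Q = enat L" "\<not> set_pmf Q \<subseteq> level_ideal P L"
    by (auto simp: eq A_def)
  have below: "set_pmf Q \<subseteq> level_ideal P l" if "l < L" for l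
  proof (rule ccontr)
    assume "\<not> ?thesis"
    then have "level P Q \<le> enat l" unfolding eq by (intro Inf_lower) (auto simp: A_def)
    with that show False by (simp add: L(1))
  qed
  show thesis by (rule that[OF L below])
qed


section \<open>Solving a system by superposition\<close>

text \<open>A combinatorial condition under which the branch entered at \<open>v\<close> from
  \<open>c\<close> can absorb any value in \<open>J\<^sub>l\<close> put on \<open>v\<close>: each
  further constraint \<open>d\<close> at \<open>v\<close> has an exit variable \<open>u\<close> that
  passes the correction on, one level down.\<close>

primrec shallow :: "('v, 'c, 'z) factor_graph_scheme \<Rightarrow> nat \<Rightarrow> 'v \<Rightarrow> 'c \<Rightarrow> bool" where
  "shallow F 0 v c \<longleftrightarrow> (\<forall>d. (d, v) \<in> edges F \<longrightarrow> d = c)"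
| "shallow F (Suc l) v c \<longleftrightarrow>
     (\<forall>d. (d, v) \<in> edges F \<and> d \<noteq> c \<longrightarrow> (\<exists>u. u \<noteq> v \<and> (d, u) \<in> edges F \<and> shallow F l u d))"

definition lhs :: "('v, 'c, 'r :: comm_ring) weighted_factor_graph \<Rightarrow> ('v \<Rightarrow> 'r) \<Rightarrow> 'c \<Rightarrow> 'r" where
  "lhs F x c = (\<Sum>v\<in>nbrs F c. edge_weight F c v * x v)"

lemma lhs_add: "lhs F (\<lambda>v. x v + y v) c = lhs F x c + lhs F y c"
  by (simp add: lhs_def distrib_left sum.distrib)

lemma lhs_sum: "lhs F (\<lambda>v. \<Sum>d\<in>D. X d v) c = (\<Sum>d\<in>D. lhs F (X d) c)"
  unfolding lhs_def sum_distrib_left by (rule sum.swap)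

lemma lhs_single:
  assumes "finite (nbrs F c)"
  shows "lhs F (\<lambda>u. if u = v then y else 0) c = (if (c, v) \<in> edges F then edge_weight F c v * y else 0)"
proof -
  have "lhs F (\<lambda>u. if u = v then y else 0) c
      = (\<Sum>u\<in>nbrs F c. if u = v then edge_weight F c v * y else 0)"
    unfolding lhs_def by (intro sum.cong) auto
  then show ?thesis using assms by (simp add: nbrs_def)
qed

lemma finite_edges: "is_factor_graph k F \<Longrightarrow> finite (edges F)"
  unfolding is_factor_graph_def by (meson finite_SigmaI finite_subset)

lemma finite_nbrs: "is_factor_graph k F \<Longrightarrow> finite (nbrs F c)"
  by (rule finite_subset[OF _ finite_imageI[OF finite_edges, of k F snd]])
     (force simp: nbrs_def)

lemma finite_constraints_at: "is_factor_graph k F \<Longrightarrow> finite {d. (d, v) \<in> edges F}"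
  by (rule finite_subset[OF _ finite_imageI[OF finite_edges, of k F fst]])
     force

text \<open>Putting \<open>y\<close> on \<open>v\<close> disturbs every other constraint
  \<open>d\<close> at \<open>v\<close> by an element of the level ideal one level down. Its negative
  is the weight at the exit variable \<open>u\<close> times some \<open>z\<close> in the value ideal
  of that level, and the induction hypothesis at \<open>u\<close> realises it without affecting any
  other constraint.\<close>

lemma shallow_solution:
  fixes P :: "('r :: {finite, comm_ring, comm_monoid_mult}) pmf"
  assumes F: "is_factor_graph k F" and w: "\<forall>(c, v)\<in>edges F. edge_weight F c v \<in> set_pmf P"
  shows "\<lbrakk>(c, v) \<in> edges F; shallow F l v c; y \<in> value_ideal P l\<rbrakk>
    \<Longrightarrow> \<exists>x. \<forall>d. lhs F x d = (if d = c then edge_weight F c v * y else 0)"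
proof (induction l arbitrary: c v y)
  case 0
  let ?x = "\<lambda>u. if u = v then y else 0"
  have "(d, v) \<in> edges F \<longleftrightarrow> d = c" for d
    using 0(1) 0(2)[unfolded shallow.simps] by blast
  then have "lhs F ?x d = (if d = c then edge_weight F c v * y else 0)" for d
    by (simp add: lhs_single[OF finite_nbrs[OF F]])
  then show ?case by (intro exI[of _ ?x] allI)
next
  case (Suc l)
  define D where "D = {d. (d, v) \<in> edges F} - {c}"
  have fin: "finite D" unfolding D_def using finite_constraints_at[OF F] by simp
  have "\<exists>x. \<forall>e. lhs F x e = (if e = d then - (edge_weight F d v * y) else 0)" if "d \<in> D" for d
  proof -
    from that have d: "(d, v) \<in> edges F" "d \<noteq> c" by (auto simp: D_def)
    with Suc.prems(2)[unfolded shallow.simps] obtain u where u: "(d, u) \<in> edges F" "shallow F l u d"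
      by blast
    have "edge_weight F d v * y \<in> level_ideal P l"
      using w d Suc.prems(3) by (intro times_value_ideal) auto
    then have "- (edge_weight F d v * y) \<in> (*) (edge_weight F d u) ` value_ideal P l"
      using w u level_ideal_subset[of "edge_weight F d u" P l] level_ideal_uminus by blast
    then obtain z where z: "z \<in> value_ideal P l" "- (edge_weight F d v * y) = edge_weight F d u * z"
      by (rule imageE)
    show ?thesis unfolding z(2) by (rule Suc.IH[OF u z(1)])
  qed
  then have "\<forall>d\<in>D. \<exists>x. \<forall>e. lhs F x e = (if e = d then - (edge_weight F d v * y) else 0)" by blast
  from bchoice[OF this] obtain X where
    X: "\<forall>d\<in>D. \<forall>e. lhs F (X d) e = (if e = d then - (edge_weight F d v * y) else 0)" ..
  \<comment> \<open>The value \<open>y\<close> at \<open>v\<close> alone, plus one correction for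
    each other constraint at \<open>v\<close>.\<close>
  let ?x = "\<lambda>u. (if u = v then y else 0) + (\<Sum>d\<in>D. X d u)"
  have "lhs F ?x e = (if e = c then edge_weight F c v * y else 0)" for e
  proof -
    have "(\<Sum>d\<in>D. lhs F (X d) e) = (\<Sum>d\<in>D. if d = e then - (edge_weight F e v * y) else 0)"
      by (intro sum.cong) (auto simp: X)
    then have "lhs F ?x e = (if (e, v) \<in> edges F then edge_weight F e v * y else 0)
        + (if e \<in> D then - (edge_weight F e v * y) else 0)"
      using fin by (simp add: lhs_add lhs_sum lhs_single[OF finite_nbrs[OF F]])
    then show ?thesis using Suc.prems(1) by (auto simp: D_def)
  qed
  then show ?case by (intro exI[of _ ?x] allI)
qed

text \<open>By linearity it suffices to serve one constraint at a time, all others being homogeneous.\<close>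

lemma satisfiable_if_shallow:
  fixes P Q :: "('r :: {finite, comm_ring, comm_monoid_mult}) pmf"
  assumes F: "is_factor_graph k F" and w: "\<forall>(c, v)\<in>edges F. edge_weight F c v \<in> set_pmf P"
    and cw: "\<forall>c\<in>constraints F. constraint_weight F c \<in> level_ideal P l"
    and sh: "\<forall>c\<in>constraints F. \<exists>v\<in>nbrs F c. shallow F l v c"
  shows "satisfiable F"
proof -
  have "\<exists>x. \<forall>d. lhs F x d = (if d = c then constraint_weight F c else 0)"
    if c: "c \<in> constraints F" for c
  proof -
    obtain v where v: "(c, v) \<in> edges F" "shallow F l v c" using sh c by (auto simp: nbrs_def)
    have "constraint_weight F c \<in> (*) (edge_weight F c v) ` value_ideal P l"
      using level_ideal_subset[of "edge_weight F c v" P l] w v cw c by blast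
    then obtain y where y: "y \<in> value_ideal P l" "constraint_weight F c = edge_weight F c v * y"
      by (rule imageE)
    show ?thesis unfolding y(2) by (rule shallow_solution[OF F w v y(1)])
  qed
  then have "\<forall>c\<in>constraints F. \<exists>x. \<forall>d. lhs F x d = (if d = c then constraint_weight F c else 0)"
    by blast
  from bchoice[OF this] obtain X where
    X: "\<forall>c\<in>constraints F. \<forall>d. lhs F (X c) d = (if d = c then constraint_weight F c else 0)" ..
  have fin: "finite (constraints F)" using F by (simp add: is_factor_graph_def)
  have "lhs F (\<lambda>v. \<Sum>c\<in>constraints F. X c v) d = constraint_weight F d"
    if d: "d \<in> constraints F" for d
  proof -
    have "(\<Sum>c\<in>constraints F. lhs F (X c) d)
        = (\<Sum>c\<in>constraints F. if c = d then constraint_weight F d else 0)"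
      by (intro sum.cong) (auto simp: X)
    with d fin show ?thesis by (simp add: lhs_sum)
  qed
  then show ?thesis unfolding satisfiable_def lhs_def
    by (intro exI[of _ "\<lambda>v. \<Sum>c\<in>constraints F. X c v"] ballI)
qed


section \<open>Counting constraints in branches\<close>

definition avoiding :: "('v, 'c, 'z) factor_graph_scheme \<Rightarrow> 'c \<Rightarrow> 'v + 'c \<Rightarrow> 'v + 'c \<Rightarrow> bool" where
  "avoiding F c x y \<longleftrightarrow> adjacent F x y \<and> x \<noteq> Inr c \<and> y \<noteq> Inr c"

text \<open>The constraints in the component of \<open>v\<close> once \<open>c\<close> is
  deleted.\<close>

definition branch :: "('v, 'c, 'z) factor_graph_scheme \<Rightarrow> 'c \<Rightarrow> 'v \<Rightarrow> 'c set" where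
  "branch F c v = {d. (avoiding F c)\<^sup>*\<^sup>* (Inl v) (Inr d)}"

lemma adjacent_sym: "adjacent F x y \<Longrightarrow> adjacent F y x"
  by (auto simp: adjacent_def)

lemma adjacent_simps [simp]:
  "adjacent F (Inl v) (Inr c) \<longleftrightarrow> (c, v) \<in> edges F"
  "adjacent F (Inr c) (Inl v) \<longleftrightarrow> (c, v) \<in> edges F"
  "\<not> adjacent F (Inl v) (Inl v')" "\<not> adjacent F (Inr c) (Inr c')"
  by (auto simp: adjacent_def)

lemma avoiding_rtranclp_sym: "(avoiding F c)\<^sup>*\<^sup>* x y \<Longrightarrow> (avoiding F c)\<^sup>*\<^sup>* y x"
  by (rule sympD[OF symp_rtranclp]) (auto simp: symp_def avoiding_def adjacent_sym)

text \<open>The trivial path may sit at \<open>Inr c\<close> itself, hence the restriction of the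
  last claim to nonempty \<open>xs\<close>.\<close>

lemma rtrancl_path_avoiding:
  "rtrancl_path (avoiding F c) x xs y \<Longrightarrow>
     successively (adjacent F) (x # xs) \<and> last (x # xs) = y \<and> (xs \<noteq> [] \<longrightarrow> Inr c \<notin> set (x # xs))"
proof (induction rule: rtrancl_path.induct)
  case (step x y ys z)
  then show ?case by (cases ys) (auto simp: avoiding_def)
qed simp

text \<open>A path from \<open>u\<close> to \<open>v\<close> avoiding \<open>c\<close>, shortened to
  distinct vertices, closes through \<open>c\<close> to a cycle.\<close>

lemma acyclic_not_avoiding:
  assumes "acyclic_graph F" "(c, u) \<in> edges F" "(c, v) \<in> edges F" "u \<noteq> v"
  shows "\<not> (avoiding F c)\<^sup>*\<^sup>* (Inl u) (Inl v)"
proof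
  assume "(avoiding F c)\<^sup>*\<^sup>* (Inl u) (Inl v)"
  then obtain xs0 where "rtrancl_path (avoiding F c) (Inl u) xs0 (Inl v)"
    by (auto simp: rtranclp_eq_rtrancl_path)
  then obtain xs where xs: "rtrancl_path (avoiding F c) (Inl u) xs (Inl v)" "distinct (Inl u # xs)"
    by (rule rtrancl_path_distinct) blast
  note path = rtrancl_path_avoiding[OF xs(1)]
  have "xs \<noteq> []" using path assms(4) by auto
  then have "is_cycle F (Inr c # Inl u # xs)"
    using path xs(2) assms by (cases xs) (auto simp: is_cycle_def)
  with assms(1) show False by (auto simp: acyclic_graph_def)
qed

lemma avoiding_target: "(avoiding F c)\<^sup>*\<^sup>* x y \<Longrightarrow> x \<noteq> Inr c \<Longrightarrow> y \<noteq> Inr c"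
  by (induction rule: rtranclp_induct) (auto simp: avoiding_def)

lemma notin_branch: "c \<notin> branch F c v"
  using avoiding_target by (fastforce simp: branch_def)

lemma disjoint_branches:
  assumes "acyclic_graph F"
  shows "disjoint_family_on (branch F c) (nbrs F c)"
  unfolding disjoint_family_on_def
proof (intro ballI impI)
  fix u v assume uv: "u \<in> nbrs F c" "v \<in> nbrs F c" "u \<noteq> v"
  have False if "d \<in> branch F c u" "d \<in> branch F c v" for d
  proof -
    have "(avoiding F c)\<^sup>*\<^sup>* (Inl u) (Inr d)" "(avoiding F c)\<^sup>*\<^sup>* (Inr d) (Inl v)"
      using that avoiding_rtranclp_sym[of F c "Inl v"] by (auto simp: branch_def)
    then have "(avoiding F c)\<^sup>*\<^sup>* (Inl u) (Inl v)" by (rule rtranclp_trans)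
    with acyclic_not_avoiding[OF assms, of c u v] uv show False by (simp add: nbrs_def)
  qed
  then show "branch F c u \<inter> branch F c v = {}" by blast
qed

lemma branch_subset_constraints:
  assumes "is_factor_graph k F"
  shows "branch F c v \<subseteq> constraints F"
proof
  fix d assume "d \<in> branch F c v"
  then have "(avoiding F c)\<^sup>*\<^sup>* (Inl v) (Inr d)" by (simp add: branch_def)
  then obtain x where "avoiding F c x (Inr d)" by (cases rule: rtranclp.cases) auto
  then obtain u where "(d, u) \<in> edges F" by (auto simp: avoiding_def adjacent_def)
  with assms show "d \<in> constraints F" by (auto simp: is_factor_graph_def)
qed

lemma mem_branch: "(d, v) \<in> edges F \<Longrightarrow> d \<noteq> c \<Longrightarrow> d \<in> branch F c v"
  unfolding branch_def by (auto simp: avoiding_def intro!: r_into_rtranclp)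

text \<open>A walk from \<open>u\<close> avoiding \<open>d\<close> cannot meet \<open>c\<close>:
  from there it could step to \<open>v\<close>, joining two neighbours of \<open>d\<close> without
  using \<open>d\<close>. So it also avoids \<open>c\<close>, and it is reached from
  \<open>v\<close> through \<open>d\<close>.\<close>

lemma branch_subset_branch:
  assumes ac: "acyclic_graph F" and e: "(c, v) \<in> edges F" "(d, v) \<in> edges F" "d \<noteq> c"
    "(d, u) \<in> edges F" "u \<noteq> v"
  shows "branch F d u \<subseteq> branch F c v"
proof
  fix b assume "b \<in> branch F d u"
  then have "(avoiding F d)\<^sup>*\<^sup>* (Inl u) (Inr b)" by (simp add: branch_def)
  moreover have "(avoiding F c)\<^sup>*\<^sup>* (Inl u) y" if "(avoiding F d)\<^sup>*\<^sup>* (Inl u) y" for y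
    using that
  proof (induction rule: rtranclp_induct)
    case (step y z)
    have "avoiding F d (Inr c) (Inl v)" using e by (simp add: avoiding_def)
    moreover have "(avoiding F d)\<^sup>*\<^sup>* (Inl u) y" "(avoiding F d)\<^sup>*\<^sup>* (Inl u) z"
      using step.hyps by auto
    ultimately have "y \<noteq> Inr c" "z \<noteq> Inr c"
      using acyclic_not_avoiding[OF ac e(4,2,5)] by (metis rtranclp.rtrancl_into_rtrancl)+
    with step show ?case
      by (auto simp: avoiding_def intro: rtranclp.rtrancl_into_rtrancl)
  qed simp
  moreover have "(avoiding F c)\<^sup>*\<^sup>* (Inl v) (Inl u)"
    by (rule rtranclp_trans[of _ _ "Inr d"]) (use e in \<open>auto simp: avoiding_def\<close>)
  ultimately show "b \<in> branch F c v" by (auto simp: branch_def intro: rtranclp_trans)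
qed

text \<open>Stated for a subset \<open>N\<close> because the recursion omits the variable it came
  from, while the final count takes all neighbours.\<close>

lemma card_UN_branches:
  assumes F: "is_factor_graph k F" and ac: "acyclic_graph F" and N: "N \<subseteq> nbrs F c"
    and g: "\<And>v. v \<in> N \<Longrightarrow> g \<le> card (branch F c v)"
  shows "1 + card N * g \<le> card (insert c (\<Union>v\<in>N. branch F c v))"
proof -
  have fin: "finite N" using N finite_nbrs[OF F] by (rule finite_subset)
  have finb: "finite (branch F c v)" for v
    using branch_subset_constraints[OF F] F by (meson finite_subset is_factor_graph_def)
  have "card N * g \<le> (\<Sum>v\<in>N. card (branch F c v))"
    using sum_bounded_below[of N g] g by simp
  also have "\<dots> = card (\<Union>v\<in>N. branch F c v)"
    using disjoint_family_on_mono[OF N disjoint_branches[OF ac]]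
    by (intro card_UN_disjoint[symmetric]) (auto simp: fin finb disjoint_family_on_def)
  finally show ?thesis using fin finb notin_branch[of c F] by (simp add: card_insert_if)
qed

text \<open>If \<open>v\<close> is not shallow, some \<open>d\<close> at \<open>v\<close> has no
  shallow exit, so its \<open>k - 1\<close> other neighbours all start large branches. These are
  disjoint and lie, with \<open>d\<close>, in the branch at \<open>v\<close>.\<close>

lemma card_branch:
  assumes F: "is_factor_graph k F" and ac: "acyclic_graph F"
  shows "(c, v) \<in> edges F \<Longrightarrow> \<not> shallow F l v c \<Longrightarrow> (\<Sum>i\<le>l. (k - 1) ^ i) \<le> card (branch F c v)"
proof (induction l arbitrary: c v)
  case 0
  have "finite (branch F c v)"
    using branch_subset_constraints[OF F] F by (meson finite_subset is_factor_graph_def)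
  moreover have "branch F c v \<noteq> {}" using 0 mem_branch by force
  ultimately show ?case by (simp add: Suc_le_eq card_gt_0_iff)
next
  case (Suc l)
  then obtain d where d: "(d, v) \<in> edges F" "d \<noteq> c"
    and ns: "\<And>u. u \<noteq> v \<Longrightarrow> (d, u) \<in> edges F \<Longrightarrow> \<not> shallow F l u d" by auto
  let ?N = "nbrs F d - {v}"
  have "d \<in> constraints F" using F d by (auto simp: is_factor_graph_def)
  then have cN: "card ?N = k - 1" using F d
    by (simp add: card_Diff_singleton nbrs_def is_factor_graph_def)
  have "(\<Sum>i\<le>Suc l. (k - 1) ^ i) = 1 + card ?N * (\<Sum>i\<le>l. (k - 1) ^ i)"
    unfolding sum.atMost_Suc_shift cN by (simp add: sum_distrib_left)
  also have "\<dots> \<le> card (insert d (\<Union>u\<in>?N. branch F d u))"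
    by (rule card_UN_branches[OF F ac]) (use Suc.IH ns in \<open>auto simp: nbrs_def\<close>)
  also have "\<dots> \<le> card (branch F c v)"
  proof (rule card_mono)
    show "finite (branch F c v)"
      using branch_subset_constraints[OF F] F by (meson finite_subset is_factor_graph_def)
    show "insert d (\<Union>u\<in>?N. branch F d u) \<subseteq> branch F c v"
      using mem_branch[OF d] branch_subset_branch[OF ac Suc.prems(1) d] by (auto simp: nbrs_def)
  qed
  finally show ?case .
qed

lemma unsat_tree_card:
  fixes P Q :: "('r :: {finite, comm_ring, comm_monoid_mult}) pmf"
  assumes T: "T \<in> unsat_trees k P Q" and Q: "\<And>l. l < L \<Longrightarrow> set_pmf Q \<subseteq> level_ideal P l"
  shows "1 + k * (\<Sum>i<L. (k - 1) ^ i) \<le> card (constraints T)"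
proof -
  have F: "is_factor_graph k T" and ac: "acyclic_graph T" and us: "\<not> satisfiable T"
    and w: "\<forall>(c, v)\<in>edges T. edge_weight T c v \<in> set_pmf P"
    and cw: "\<forall>c\<in>constraints T. constraint_weight T c \<in> set_pmf Q"
    using T by (auto simp: unsat_trees_def)
  have fin: "finite (constraints T)" using F by (simp add: is_factor_graph_def)
  have "\<exists>c\<in>constraints T. \<forall>v\<in>nbrs T c. (\<Sum>i<L. (k - 1) ^ i) \<le> card (branch T c v)"
  proof (cases L)
    case 0
    \<comment> \<open>For \<open>L = 0\<close> the bound is 1, and a system without constraints is
      satisfiable.\<close>
    have "constraints T \<noteq> {}" using us by (auto simp: satisfiable_def)
    with 0 show ?thesis by auto
  next
    case (Suc l)
    \<comment> \<open>The assumption on \<open>Q\<close> is used at \<open>L - 1\<close>, the last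
      level below \<open>L\<close>.\<close>
    have "\<forall>c\<in>constraints T. constraint_weight T c \<in> level_ideal P l"
      using cw Q[of l] Suc by auto
    then obtain c where c: "c \<in> constraints T" "\<And>v. v \<in> nbrs T c \<Longrightarrow> \<not> shallow T l v c"
      using satisfiable_if_shallow[OF F w] us by blast
    have "(\<Sum>i\<le>l. (k - 1) ^ i) \<le> card (branch T c v)" if "v \<in> nbrs T c" for v
      using card_branch[OF F ac] c(2) that by (simp add: nbrs_def)
    with c(1) Suc show ?thesis by (auto simp: lessThan_Suc_atMost)
  qed
  then obtain c where c: "c \<in> constraints T"
    "\<And>v. v \<in> nbrs T c \<Longrightarrow> (\<Sum>i<L. (k - 1) ^ i) \<le> card (branch T c v)" by blast
  have "1 + k * (\<Sum>i<L. (k - 1) ^ i) = 1 + card (nbrs T c) * (\<Sum>i<L. (k - 1) ^ i)"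
    using F c(1) by (simp add: is_factor_graph_def)
  also have "\<dots> \<le> card (insert c (\<Union>v\<in>nbrs T c. branch T c v))"
    by (rule card_UN_branches[OF F ac]) (use c(2) in auto)
  also have "\<dots> \<le> card (constraints T)"
    using c(1) branch_subset_constraints[OF F] fin by (intro card_mono) auto
  finally show ?thesis .
qed


section \<open>Relabelling by natural numbers\<close>

text \<open>Cutting the cycle at \<open>x\<close> leaves a path \<open>vs @ us\<close> whose two
  ends are the neighbours of \<open>x\<close>.\<close>

lemma cycle_neighbours:
  assumes "is_cycle F xs" "x \<in> set xs"
  obtains y z where "y \<in> set xs" "z \<in> set xs" "y \<noteq> z" "adjacent F x y" "adjacent F x z"
proof -
  obtain us vs where xs: "xs = us @ x # vs" using assms(2) by (auto simp: in_set_conv_decomp)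
  let ?ys = "vs @ us"
  have len: "2 \<le> length ?ys" and dist: "distinct ?ys"
    and suc: "successively (adjacent F) (us @ x # vs)"
    and closed: "adjacent F (last (us @ x # vs)) (hd (us @ x # vs))"
    using assms(1) by (auto simp: is_cycle_def xs)
  have ne: "?ys \<noteq> []" using len by auto
  have "hd ?ys \<noteq> last ?ys"
  proof -
    obtain a b bs where "?ys = a # b # bs"
      using len by (metis One_nat_def Suc_1 Suc_le_length_iff)
    with dist show ?thesis by auto
  qed
  moreover have "adjacent F x (hd ?ys)"
    using suc closed ne by (cases vs) (auto simp: successively_append_iff)
  moreover have "adjacent F x (last ?ys)"
    using suc closed ne
    by (cases us rule: rev_cases; cases us; cases vs rule: rev_cases)
       (auto simp: successively_append_iff intro: adjacent_sym split: if_splits)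
  moreover have "hd ?ys \<in> set xs" "last ?ys \<in> set xs"
    using hd_in_set[OF ne] last_in_set[OF ne] by (auto simp: xs)
  ultimately show thesis using that by blast
qed

text \<open>Carries the tree built below, whose vertices are made of lists, into
  \<open>unsat_trees\<close>, whose members are labelled by naturals.\<close>

definition relabel ::
    "('v :: countable, 'c :: countable, 'r) weighted_factor_graph \<Rightarrow> (nat, nat, 'r) weighted_factor_graph"
  where
  "relabel F = \<lparr>variables = to_nat ` variables F, constraints = to_nat ` constraints F,
     edges = map_prod to_nat to_nat ` edges F,
     edge_weight = (\<lambda>c v. edge_weight F (from_nat c) (from_nat v)),
     constraint_weight = (\<lambda>c. constraint_weight F (from_nat c))\<rparr>"

lemma relabel_simps [simp]:
  "variables (relabel F) = to_nat ` variables F"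
  "constraints (relabel F) = to_nat ` constraints F"
  "edges (relabel F) = map_prod to_nat to_nat ` edges F"
  "edge_weight (relabel F) c v = edge_weight F (from_nat c) (from_nat v)"
  "constraint_weight (relabel F) c = constraint_weight F (from_nat c)"
  by (simp_all add: relabel_def)

lemma nbrs_relabel: "nbrs (relabel F) (to_nat c) = to_nat ` nbrs F c"
  by (force simp: nbrs_def)

lemma is_factor_graph_relabel: "is_factor_graph k F \<Longrightarrow> is_factor_graph k (relabel F)"
  by (auto simp: is_factor_graph_def nbrs_relabel card_image)

lemma adjacent_relabelI:
  "adjacent F x y \<Longrightarrow> adjacent (relabel F) (map_sum to_nat to_nat x) (map_sum to_nat to_nat y)"
  by (cases x; cases y) (auto simp: rev_image_eqI)

lemma adjacent_relabelD:
  fixes F :: "('v :: countable, 'c :: countable, 'r) weighted_factor_graph"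
  assumes "adjacent (relabel F) x y"
  shows "adjacent F (map_sum from_nat from_nat x) (map_sum from_nat from_nat y)"
    "map_sum to_nat to_nat (map_sum from_nat from_nat x :: 'v + 'c) = x"
  using assms by (auto simp: adjacent_def intro!: bexI)

lemma connected_graph_relabel:
  assumes "connected_graph F"
  shows "connected_graph (relabel F)"
proof -
  have v: "vertices (relabel F) = map_sum to_nat to_nat ` vertices F"
    by (simp add: vertices_def Plus_def image_Un image_image)
  have "(adjacent (relabel F))\<^sup>*\<^sup>* (map_sum to_nat to_nat x) (map_sum to_nat to_nat y)"
    if "(adjacent F)\<^sup>*\<^sup>* x y" for x y
    using that by induction (auto intro: rtranclp.rtrancl_into_rtrancl adjacent_relabelI)
  with assms show ?thesis by (auto simp: connected_graph_def v)
qed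

text \<open>\<open>from_nat\<close> need not be injective on all naturals, but it is on a cycle:
  vertices there are endpoints of edges, hence codes.\<close>

lemma acyclic_graph_relabel:
  fixes F :: "('v :: countable, 'c :: countable, 'r) weighted_factor_graph"
  assumes "acyclic_graph F"
  shows "acyclic_graph (relabel F)"
  unfolding acyclic_graph_def
proof
  assume "\<exists>xs. is_cycle (relabel F) xs"
  then obtain xs where xs: "is_cycle (relabel F) xs" ..
  let ?h = "map_sum from_nat from_nat :: nat + nat \<Rightarrow> 'v + 'c"
  have "map_sum to_nat to_nat (?h x) = x" if "x \<in> set xs" for x
    using cycle_neighbours[OF xs that] adjacent_relabelD(2) by metis
  then have "inj_on ?h (set xs)" by (metis inj_onI)
  moreover have "successively (adjacent F) (map ?h xs)"
    unfolding successively_map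
    by (rule successively_mono[of "adjacent (relabel F)"])
       (use xs in \<open>auto simp: is_cycle_def adjacent_relabelD\<close>)
  moreover have "xs \<noteq> []" using xs by (auto simp: is_cycle_def)
  ultimately have "is_cycle F (map ?h xs)"
    using xs by (auto simp: is_cycle_def distinct_map last_map hd_map adjacent_relabelD)
  with assms show False by (auto simp: acyclic_graph_def)
qed

lemma satisfiable_relabelD:
  assumes "satisfiable (relabel F)"
  shows "satisfiable F"
proof -
  obtain x where x: "\<And>c. c \<in> constraints F \<Longrightarrow>
      (\<Sum>v\<in>nbrs (relabel F) (to_nat c). edge_weight F c (from_nat v) * x v) = constraint_weight F c"
    using assms by (auto simp: satisfiable_def)
  show ?thesis unfolding satisfiable_def
    by (rule exI[of _ "\<lambda>v. x (to_nat v)"]) (use x in \<open>simp add: nbrs_relabel sum.reindex\<close>)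
qed

lemma relabel_unsat_tree:
  fixes F :: "('v :: countable, 'c :: countable, 'r :: {finite, comm_ring, comm_monoid_mult})
    weighted_factor_graph"
  assumes "is_factor_graph k F" "connected_graph F" "acyclic_graph F" "\<not> satisfiable F"
    "\<And>c v. (c, v) \<in> edges F \<Longrightarrow> edge_weight F c v \<in> set_pmf P"
    "\<And>c. c \<in> constraints F \<Longrightarrow> constraint_weight F c \<in> set_pmf Q"
  shows "relabel F \<in> unsat_trees k P Q"
  using assms satisfiable_relabelD
  by (auto simp: unsat_trees_def is_factor_graph_relabel connected_graph_relabel
      acyclic_graph_relabel)


section \<open>An unsatisfiable tree\<close>

text \<open>A deepest vertex of a cycle has two distinct neighbours on it, neither of them
  deeper.\<close>

lemma acyclic_graph_if_depth:
  fixes depth :: "'v + 'c \<Rightarrow> nat"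
  assumes "\<And>x y z. \<lbrakk>adjacent F x y; adjacent F x z; depth y \<le> depth x; depth z \<le> depth x\<rbrakk> \<Longrightarrow> y = z"
  shows "acyclic_graph F"
  unfolding acyclic_graph_def
proof
  assume "\<exists>xs. is_cycle F xs"
  then obtain xs where xs: "is_cycle F xs" ..
  then have "set xs \<noteq> {}" by (auto simp: is_cycle_def)
  then have "Max (depth ` set xs) \<in> depth ` set xs" by (intro Max_in) auto
  then obtain x where "x \<in> set xs" "depth x = Max (depth ` set xs)" by auto
  then have x: "x \<in> set xs" "\<And>y. y \<in> set xs \<Longrightarrow> depth y \<le> depth x" by auto
  from cycle_neighbours[OF xs x(1)] assms x(2) show False by metis
qed

type_synonym 'r address = "(nat \<times> 'r \<times> 'r) list"

text \<open>
  A constraint is addressed by its path from the root constraint, most recent step first. The step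
  \<open>(j, s, r)\<close> goes to the \<open>j\<close>-th child variable of the current constraint and from there, along an
  edge of weight \<open>s\<close>, to a constraint whose edges to its own children have weight \<open>r\<close>. The pair
  \<open>(c, j)\<close> is the \<open>j\<close>-th child variable of \<open>c\<close>.
\<close>

fun arity :: "nat \<Rightarrow> 'r address \<Rightarrow> nat" where
  "arity k [] = k"
| "arity k (_ # _) = k - 1"

fun address :: "nat \<Rightarrow> 'r set \<Rightarrow> 'r address \<Rightarrow> bool" where
  "address k S [] \<longleftrightarrow> True"
| "address k S ((j, s, r) # c) \<longleftrightarrow> j < arity k c \<and> s \<in> S \<and> r \<in> S \<and> address k S c"

definition addresses :: "nat \<Rightarrow> 'r set \<Rightarrow> nat \<Rightarrow> 'r address set" where
  "addresses k S n = {c. address k S c \<and> length c = n}"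

lemma addresses_0: "addresses k S 0 = {[]}"
  by (auto simp: addresses_def)

lemma addresses_Suc:
  "addresses k S (Suc n)
    = (\<lambda>(c, a). a # c) ` (SIGMA c:addresses k S n. {..<arity k c} \<times> S \<times> S)"
  by (force simp: addresses_def length_Suc_conv image_iff)

text \<open>The root offers \<open>k\<close> child variables and every later constraint
  \<open>k - 1\<close>; each step also chooses a pair from \<open>S\<close>, giving two factors
  \<open>card S\<close>.\<close>

lemma card_addresses_Suc:
  assumes "finite S"
  shows "finite (addresses k S n)"
    and "card (addresses k S (Suc n)) = k * (k - 1) ^ n * card S ^ (2 * Suc n)"
proof -
  show fin: "finite (addresses k S n)" for n
    by (induction n) (use assms in \<open>auto simp: addresses_0 addresses_Suc\<close>)
  have card: "card (addresses k S (Suc n)) = (\<Sum>c\<in>addresses k S n. arity k c * (card S * card S))" for n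
    unfolding addresses_Suc
    by (subst card_image) (use fin assms in \<open>auto simp: inj_on_def card_SigmaI card_cartesian_product\<close>)
  show "card (addresses k S (Suc n)) = k * (k - 1) ^ n * card S ^ (2 * Suc n)"
  proof (induction n)
    case 0
    then show ?case by (simp add: card addresses_0 power2_eq_square)
  next
    case (Suc n)
    have "arity k c = k - 1" if "c \<in> addresses k S (Suc n)" for c
      using that by (cases c) (auto simp: addresses_def)
    then have "card (addresses k S (Suc (Suc n)))
        = card (addresses k S (Suc n)) * ((k - 1) * (card S * card S))"
      unfolding card[of "Suc n"] by simp
    then show ?case by (simp add: Suc.IH algebra_simps)
  qed
qed

text \<open>Constraints at depth \<open>L\<close> keep their child variables, so they too have
  degree \<open>k\<close>. In \<open>edge_weight\<close>, the test \<open>d = c\<close> separates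
  edges to the children from the edge to the parent variable.\<close>

definition address_tree ::
    "nat \<Rightarrow> 'r set \<Rightarrow> nat \<Rightarrow> 'r \<Rightarrow> 'r \<Rightarrow> ('r address \<times> nat, 'r address, 'r) weighted_factor_graph"
  where
  "address_tree k S L r q = (let C = {c. address k S c \<and> length c \<le> L} in
     \<lparr>variables = (SIGMA c:C. {..<arity k c}), constraints = C,
      edges = {(c, (c, j)) |c j. c \<in> C \<and> j < arity k c} \<union> {(a # c, (c, fst a)) |a c. a # c \<in> C},
      edge_weight = (\<lambda>c (d, j). case c of [] \<Rightarrow> r | (i, s, t) # _ \<Rightarrow> if d = c then t else s),
      constraint_weight = (\<lambda>c. q)\<rparr>)"

lemma constraints_address_tree:
  "constraints (address_tree k S L r q) = {c. address k S c \<and> length c \<le> L}"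
  by (simp add: address_tree_def Let_def)

lemma edges_address_tree:
  "edges (address_tree k S L r q) = {(c, (c, j)) |c j. address k S c \<and> length c \<le> L \<and> j < arity k c}
     \<union> {(a # c, (c, fst a)) |a c. address k S (a # c) \<and> length c < L}"
  by (auto simp: address_tree_def Let_def Suc_le_eq)

lemma weights_address_tree:
  "edge_weight (address_tree k S L r q) [] v = r"
  "edge_weight (address_tree k S L r q) ((i, s, t) # c) ((i, s, t) # c, j) = t"
  "edge_weight (address_tree k S L r q) ((i, s, t) # c) (c, j) = s"
  "constraint_weight (address_tree k S L r q) c = q"
  by (auto simp: address_tree_def Let_def split: prod.splits)

lemma nbrs_address_tree:
  "nbrs (address_tree k S L r q) [] = Pair [] ` {..<k}"
  "address k S (a # c) \<Longrightarrow> length c < L \<Longrightarrow>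
    nbrs (address_tree k S L r q) (a # c) = insert (c, fst a) (Pair (a # c) ` {..<k - 1})"
  by (cases a; auto simp: nbrs_def edges_address_tree)+

lemma card_constraints_address_tree:
  assumes "finite S"
  shows "finite (constraints (address_tree k S L r q))"
    and "card (constraints (address_tree k S L r q))
      = 1 + (\<Sum>i<L. k * (k - 1) ^ i * card S ^ (2 * Suc i))"
proof -
  have eq: "constraints (address_tree k S L r q) = (\<Union>n\<le>L. addresses k S n)"
    by (auto simp: constraints_address_tree addresses_def)
  show "finite (constraints (address_tree k S L r q))"
    unfolding eq using card_addresses_Suc(1)[OF assms] by auto
  have "card (constraints (address_tree k S L r q)) = (\<Sum>n\<le>L. card (addresses k S n))"
    unfolding eq
    by (rule card_UN_disjoint) (use card_addresses_Suc(1)[OF assms] in \<open>auto simp: addresses_def\<close>)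
  then show "card (constraints (address_tree k S L r q))
      = 1 + (\<Sum>i<L. k * (k - 1) ^ i * card S ^ (2 * Suc i))"
    by (simp add: sum.atMost_shift addresses_0 card_addresses_Suc(2)[OF assms] del: power_Suc mult_Suc_right)
qed

lemma address_treeI:
  fixes S :: "'r :: finite set"
  assumes "k \<ge> 1"
  shows "is_factor_graph k (address_tree k S L r q)"
    and "connected_graph (address_tree k S L r q)"
    and "acyclic_graph (address_tree k S L r q)"
proof -
  let ?T = "address_tree k S L r q"
  have vars: "variables ?T = (SIGMA c:constraints ?T. {..<arity k c})"
    by (simp add: address_tree_def Let_def)
  have edges: "edges ?T \<subseteq> constraints ?T \<times> variables ?T"
    by (auto simp: edges_address_tree vars constraints_address_tree)
  have "card (nbrs ?T c) = k" if "c \<in> constraints ?T" for c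
  proof (cases c)
    case Nil
    then show ?thesis by (simp add: nbrs_address_tree card_image inj_on_def)
  next
    case (Cons a d)
    \<comment> \<open>The parent variable is none of the \<open>k - 1\<close> children, so the
      degree is \<open>k\<close>.\<close>
    moreover have "(d, fst a) \<notin> Pair (a # d) ` {..<k - 1}" by auto
    ultimately show ?thesis
      using that assms by (simp add: nbrs_address_tree constraints_address_tree card_image inj_on_def)
  qed
  with edges show "is_factor_graph k ?T"
    by (auto simp: is_factor_graph_def vars card_constraints_address_tree)

  have root: "(adjacent ?T)\<^sup>*\<^sup>* (Inr []) (Inr c)" if "c \<in> constraints ?T" for c
    using that
  proof (induction c)
    case (Cons a c)
    then have a: "address k S (a # c)" "length c < L" by (auto simp: constraints_address_tree)
    then have c: "address k S c" "fst a < arity k c" by (cases a, auto)+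
    have "(c, (c, fst a)) \<in> edges ?T" "(a # c, (c, fst a)) \<in> edges ?T"
      using a c by (cases a; auto simp: edges_address_tree)+
    then have "adjacent ?T (Inr c) (Inl (c, fst a))" "adjacent ?T (Inl (c, fst a)) (Inr (a # c))"
      by auto
    moreover have "(adjacent ?T)\<^sup>*\<^sup>* (Inr []) (Inr c)"
      using Cons.IH a c by (simp add: constraints_address_tree)
    ultimately show ?case by (meson rtranclp.rtrancl_into_rtrancl)
  qed simp
  have root': "(adjacent ?T)\<^sup>*\<^sup>* (Inr []) x" if x: "x \<in> vertices ?T" for x
  proof (cases x)
    case (Inl v)
    then obtain c j where v: "v = (c, j)" "c \<in> constraints ?T" "j < arity k c"
      using x by (auto simp: vertices_def vars)
    then have "adjacent ?T (Inr c) x"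
      by (auto simp: Inl edges_address_tree constraints_address_tree)
    with root[OF v(2)] show ?thesis by (rule rtranclp.rtrancl_into_rtrancl)
  qed (use x root in \<open>auto simp: vertices_def\<close>)
  moreover have "symp (adjacent ?T)" by (auto simp: symp_def adjacent_sym)
  ultimately have "(adjacent ?T)\<^sup>*\<^sup>* x y" if "x \<in> vertices ?T" "y \<in> vertices ?T" for x y
    using that by (meson rtranclp_trans sympD symp_rtranclp)
  moreover have "Inr [] \<in> vertices ?T" by (auto simp: vertices_def constraints_address_tree)
  ultimately show "connected_graph ?T" by (auto simp: connected_graph_def)

  \<comment> \<open>Distance from the root constraint: every neighbour except the parent is
    deeper.\<close>
  let ?depth = "case_sum (\<lambda>v. 2 * length (fst v) + 1) (\<lambda>c. 2 * length c)
    :: ('r address \<times> nat) + 'r address \<Rightarrow> nat"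
  show "acyclic_graph ?T"
    by (rule acyclic_graph_if_depth[where depth = ?depth])
       (auto simp: adjacent_def edges_address_tree)
qed

text \<open>Here \<open>m\<close> is the height above the deepest constraints, where nothing is
  claimed. Higher up, the constraint \<open>(j, s, t) # c\<close> reads
  \<open>s * x (c, j) + t * z = q\<close> with \<open>z\<close> in the value ideal of level
  \<open>m\<close> by induction, and \<open>q\<close> is \<open>t\<close> times a member of that
  ideal.\<close>

lemma address_tree_value_ideal:
  fixes P :: "('r :: {finite, comm_ring, comm_monoid_mult}) pmf"
  assumes k: "k \<ge> 1" and q: "\<And>l. l < L \<Longrightarrow> q \<in> level_ideal P l"
    and x: "\<forall>c\<in>constraints (address_tree k (set_pmf P) L r q).
      lhs (address_tree k (set_pmf P) L r q) x c = q"
  shows "\<lbrakk>address k (set_pmf P) c; length c + m = L; j < arity k c\<rbrakk> \<Longrightarrow> x (c, j) \<in> value_ideal P m"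
proof (induction m arbitrary: c j)
  case (Suc m)
  let ?T = "address_tree k (set_pmf P) L r q"
  have "s * x (c, j) \<in> (*) t ` value_ideal P m" if st: "s \<in> set_pmf P" "t \<in> set_pmf P" for s t
  proof -
    let ?d = "(j, s, t) # c"
    have d: "address k (set_pmf P) ?d" "length ?d + m = L" using Suc.prems st by auto
    define z where "z = (\<Sum>i<k - 1. x (?d, i))"
    have z: "z \<in> value_ideal P m"
      unfolding z_def using Suc.IH[OF d] by (intro value_ideal_sum) auto
    have notin: "(c, j) \<notin> Pair ?d ` {..<k - 1}" by auto
    have "lhs ?T x ?d = s * x (c, j) + (\<Sum>i<k - 1. t * x (?d, i))"
      unfolding lhs_def using d notin
      by (subst nbrs_address_tree(2))
         (auto simp: weights_address_tree sum.reindex inj_on_def)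
    moreover have "?d \<in> constraints ?T" using d by (simp add: constraints_address_tree)
    ultimately have eq: "s * x (c, j) = q - t * z"
      using x by (simp add: z_def sum_distrib_left eq_diff_eq)
    have "q \<in> (*) t ` value_ideal P m"
      using q[of m] Suc.prems level_ideal_subset[OF st(2), of m] by auto
    with z show ?thesis unfolding eq by (auto intro!: image_times_diff value_ideal_diff)
  qed
  then show ?case by (auto simp: colon_def level_ideal_eq)
qed simp

text \<open>The root equation would write \<open>q\<close> as \<open>r\<close> times a sum of values
  in \<open>value_ideal P L\<close>.\<close>

lemma address_tree_unsat:
  fixes P :: "('r :: {finite, comm_ring, comm_monoid_mult}) pmf"
  assumes "k \<ge> 1" "\<And>l. l < L \<Longrightarrow> q \<in> level_ideal P l" "q \<notin> (*) r ` value_ideal P L"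
  shows "\<not> satisfiable (address_tree k (set_pmf P) L r q)"
proof
  let ?T = "address_tree k (set_pmf P) L r q"
  assume "satisfiable ?T"
  then obtain x where x: "\<forall>c\<in>constraints ?T. lhs ?T x c = q"
    by (auto simp: satisfiable_def lhs_def weights_address_tree)
  have "lhs ?T x [] = r * (\<Sum>j<k. x ([], j))"
    by (simp add: lhs_def nbrs_address_tree weights_address_tree sum.reindex inj_on_def sum_distrib_left)
  moreover have "lhs ?T x [] = q" using x by (simp add: constraints_address_tree)
  moreover have "(\<Sum>j<k. x ([], j)) \<in> value_ideal P L"
    using address_tree_value_ideal[OF assms(1,2) x, of "[]"] by (intro value_ideal_sum) auto
  ultimately show False using assms(3) by auto
qed

lemma unsat_tree_exists:
  fixes P Q :: "('r :: {finite, comm_ring, comm_monoid_mult}) pmf"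
  assumes k: "k \<ge> 1" and L: "\<not> set_pmf Q \<subseteq> level_ideal P L"
    and Q: "\<And>l. l < L \<Longrightarrow> set_pmf Q \<subseteq> level_ideal P l"
  obtains T where "T \<in> unsat_trees k P Q"
    "card (constraints T) = 1 + (\<Sum>i<L. k * (k - 1) ^ i * card (set_pmf P) ^ (2 * Suc i))"
proof -
  \<comment> \<open>A \<open>q\<close> outside the intersection \<open>level_ideal P L\<close> is
    missed by the term of some \<open>r\<close>, which becomes the weight at the root.\<close>
  obtain q r where q: "q \<in> set_pmf Q" and r: "r \<in> set_pmf P" and qr: "q \<notin> (*) r ` value_ideal P L"
    using L by (auto simp: level_ideal_eq)
  let ?T = "address_tree k (set_pmf P) L r q"
  have "edge_weight ?T c v \<in> set_pmf P" if "(c, v) \<in> edges ?T" for c v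
    using that r by (cases c) (auto simp: edges_address_tree weights_address_tree)
  moreover have "\<not> satisfiable ?T"
    using q Q by (intro address_tree_unsat[OF k _ qr]) blast
  ultimately have "relabel ?T \<in> unsat_trees k P Q"
    using q by (intro relabel_unsat_tree address_treeI[OF k]) (simp_all add: weights_address_tree)
  moreover have "card (constraints (relabel ?T)) = card (constraints ?T)"
    by (simp add: card_image)
  ultimately show thesis
    using that[of "relabel ?T"] by (simp add: card_constraints_address_tree(2))
qed


section \<open>The bounds\<close>

theorem theorem1p10:
  fixes P Q :: "('r :: {finite, comm_ring, comm_monoid_mult}) pmf" and k p :: nat
  assumes "k \<ge> 3"
    and "p = card (set_pmf P)"
    and "level P Q < \<infinity>"
  shows "(\<Sum>i=1..the_enat (level P Q). real k * (real k - 1) ^ (i - 1)) /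
           (1 + (\<Sum>i=1..the_enat (level P Q). real k * (real k - 1) ^ (i - 1)))
         \<le> alpha k P Q
       \<and> alpha k P Q \<le>
         (\<Sum>i=1..the_enat (level P Q). real k * (real k - 1) ^ (i - 1) * real p ^ (2 * i)) /
           (1 + (\<Sum>i=1..the_enat (level P Q). real k * (real k - 1) ^ (i - 1) * real p ^ (2 * i)))"
proof -
  obtain L where L: "level P Q = enat L" "\<not> set_pmf Q \<subseteq> level_ideal P L"
    and Q: "\<And>l. l < L \<Longrightarrow> set_pmf Q \<subseteq> level_ideal P l"
    using level_eq_enatD[OF assms(3)] by blast
  have k: "k \<ge> 1" using assms(1) by simp
  \<comment> \<open>\<open>a\<close> and \<open>b\<close> bound the number of constraints other than
    one root in a smallest unsatisfiable tree.\<close>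
  define a where "a = k * (\<Sum>i<L. (k - 1) ^ i)"
  define b where "b = (\<Sum>i<L. k * (k - 1) ^ i * p ^ (2 * Suc i))"
  let ?U = "unsat_trees k P Q"
  let ?n = "INF T\<in>?U. card (constraints T)"
  obtain T where T: "T \<in> ?U" "card (constraints T) = 1 + b"
    unfolding b_def assms(2) by (rule unsat_tree_exists[OF k L(2) Q])
  have lower: "1 + a \<le> ?n"
    using T(1) unsat_tree_card[OF _ Q] unfolding a_def by (intro cINF_greatest) auto
  have upper: "?n \<le> 1 + b"
    unfolding T(2)[symmetric] by (rule cINF_lower[OF _ T(1)]) simp
  \<comment> \<open>Turns bounds on the smallest size into bounds on \<open>alpha\<close>;
    \<open>T\<close> shows that the default value 1 is not taken.\<close>
  have mono: "1 - 1 / real x \<le> 1 - 1 / real y" if "0 < x" "x \<le> y" for x y :: nat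
    using that by (simp add: frac_le)
  have "1 - 1 / real (1 + a) \<le> alpha k P Q" "alpha k P Q \<le> 1 - 1 / real (1 + b)"
    using T(1) mono[OF _ lower] mono[OF _ upper] lower by (auto simp: alpha_def)
  moreover have "1 - 1 / real (1 + x) = real x / (1 + real x)" for x
    by (simp add: field_simps)
  moreover have "(\<Sum>i=1..L. real k * (real k - 1) ^ (i - 1)) = real a"
    using assms(1) by (simp add: a_def sum.atLeast1_atMost_eq sum_distrib_left of_nat_diff)
  moreover have "(\<Sum>i=1..L. real k * (real k - 1) ^ (i - 1) * real p ^ (2 * i)) = real b"
    using assms(1) by (simp add: b_def sum.atLeast1_atMost_eq of_nat_diff)
  ultimately show ?thesis by (simp add: L(1))
qed

end
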